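(* Let $H$ be a graded nilpotent Lie group of step $s\ge2$. Then there exist $\lambda_2,\dots,\lambda_s>0$ and $C>0$ depending only on $H$ such that, if $N=N_s$ is the group norm constructed from $\lambda_2,\dots,\lambda_s$ by $$N_2(x)=\left(|x_1|^4+\lambda_2|x_2|^2\right)^{1/4},\qquad N_k(x)=\left(N_{k-1}(x)^{2k!}+\lambda_k|x_k|^{2(k-1)!}\right)^{1/(2k!)}\quad(3\le k\le s),$$ then for all $g,h\in H$, $$\frac12\left(N(g)^{2s!}+N(h)^{2s!}\right)\ge\left(\frac{N(gh)}2\right)^{2s!}+C\,2^{-2s!}\left(|g_1-h_1|^{2s!}+NH(gh)^{2s!}\right).$$ Here $2s!$ means $2\cdot(s!)$, and similarly for $2k!$ and $2(k-1)!$.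
   Context: A graded nilpotent Lie group of step $s$ is a simply connected Lie group $H$ whose Lie algebra decomposes as $\mathfrak h=\bigoplus_{j=1}^s\mathcal V_j$ with $[\mathcal V_i,\mathcal V_j]\subset\mathcal V_{i+j}$ ($\mathcal V_k=0$ for $k>s$). Each layer $\mathcal V_j$ carries a Euclidean norm $|\cdot|$. $H$ is identified with $\mathfrak h$ through the exponential map (a diffeomorphism), so elements are written $g=(g_1,\dots,g_s)$ with $g_j\in\mathcal V_j$, and the product is given by the Baker-Campbell-Hausdorff formula. $\tilde\pi(g)=(g_1,0,\dots,0)$, and $NH(g)=N(\tilde\pi(g)^{-1}g)$. *)

theory Defs
  imports "HOL-Analysis.Analysis"
begin

text \<open>
  A simply connected nilpotent Lie group is identified with its Lie algebra through the
  exponential map, so the group is the underlying vector space with the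
  Baker-Campbell-Hausdorff product.  The layers carry the restrictions of the ambient Euclidean
  norm.  Any choice of Euclidean norms on the layers arises in this way (take the
  orthogonal direct sum of the layers); orthogonality of distinct layers is not required.
\<close>

locale lie_algebra =
  fixes br :: "'a::real_vector \<Rightarrow> 'a \<Rightarrow> 'a"
  assumes bilinear: "bilinear br"
    and alternating: "br x x = 0"
    and jacobi: "br x (br y z) + br y (br z x) + br z (br x y) = 0"

definition decomposition :: "nat \<Rightarrow> (nat \<Rightarrow> 'a::real_vector set) \<Rightarrow> 'a \<Rightarrow> (nat \<Rightarrow> 'a) \<Rightarrow> bool" where
  "decomposition s V x v \<longleftrightarrow>
     (\<forall>j\<in>{1..s}. v j \<in> V j) \<and> (\<forall>j. j \<notin> {1..s} \<longrightarrow> v j = 0) \<and> x = (\<Sum>j=1..s. v j)"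

locale graded_lie_algebra = lie_algebra br
  for br :: "'a::euclidean_space \<Rightarrow> 'a \<Rightarrow> 'a" +
  fixes s :: nat and V :: "nat \<Rightarrow> 'a set"
  assumes layer_subspace: "1 \<le> j \<Longrightarrow> subspace (V j)"
    and layer_trivial: "s < k \<Longrightarrow> V k = {0}"
    and direct_sum: "\<exists>!v. decomposition s V x v"
    and grading: "\<lbrakk>1 \<le> i; 1 \<le> j; x \<in> V i; y \<in> V j\<rbrakk> \<Longrightarrow> br x y \<in> V (i + j)"

text \<open>\<open>layer s V x j\<close> is the coordinate \<open>x\<^sub>j\<close>, regarded as an element of the whole Lie algebra;
  in particular \<open>(x\<^sub>1, 0, \<dots>, 0)\<close> is \<open>layer s V x 1\<close>.\<close>

definition layer :: "nat \<Rightarrow> (nat \<Rightarrow> 'a::real_vector set) \<Rightarrow> 'a \<Rightarrow> nat \<Rightarrow> 'a" where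
  "layer s V x = (THE v. decomposition s V x v)"

definition horizontal :: "nat \<Rightarrow> (nat \<Rightarrow> 'a::real_vector set) \<Rightarrow> 'a \<Rightarrow> 'a" where
  "horizontal s V x = layer s V x 1"

text \<open>
  The Baker-Campbell-Hausdorff product in Dynkin's form,
  \[ \sum_{n \ge 1} \frac{(-1)^{n-1}}{n} \sum_{p_i + q_i > 0}
     \frac{[x^{p_1} y^{q_1} \cdots x^{p_n} y^{q_n}]}
          {\bigl(\sum_i (p_i + q_i)\bigr) \prod_i p_i!\, q_i!}, \]
  with right-nested brackets.  Brackets of more than \<open>s\<close> elements vanish in a Lie algebra graded
  by \<open>1, \<dots>, s\<close>, so the series is cut off at total degree \<open>s\<close>.
\<close>

fun nested_bracket :: "('a \<Rightarrow> 'a \<Rightarrow> 'a) \<Rightarrow> 'a::zero list \<Rightarrow> 'a" where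
  "nested_bracket br [] = 0"
| "nested_bracket br [a] = a"
| "nested_bracket br (a # b # w) = br a (nested_bracket br (b # w))"

definition bch_word :: "'a \<Rightarrow> 'a \<Rightarrow> (nat \<times> nat) list \<Rightarrow> 'a list" where
  "bch_word x y ps = concat (map (\<lambda>(p, q). replicate p x @ replicate q y) ps)"

definition bch_degree :: "(nat \<times> nat) list \<Rightarrow> nat" where
  "bch_degree ps = (\<Sum>(p, q)\<leftarrow>ps. p + q)"

definition bch_index :: "nat \<Rightarrow> nat \<Rightarrow> (nat \<times> nat) list set" where
  "bch_index s n = {ps. length ps = n \<and> (\<forall>(p, q)\<in>set ps. 0 < p + q) \<and> bch_degree ps \<le> s}"

lemma finite_bch_index: "finite (bch_index s n)"
proof (rule finite_subset)
  show "bch_index s n \<subseteq> {ps. set ps \<subseteq> {..s} \<times> {..s} \<and> length ps = n}"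
  proof
    fix ps assume ps: "ps \<in> bch_index s n"
    have "p \<le> s \<and> q \<le> s" if "(p, q) \<in> set ps" for p q
    proof -
      have "p + q \<in> set (map (\<lambda>(p, q). p + q) ps)"
        using that by force
      then have "p + q \<le> bch_degree ps"
        unfolding bch_degree_def by (intro member_le_sum_list) auto
      then show ?thesis using ps by (simp add: bch_index_def)
    qed
    then show "ps \<in> {ps. set ps \<subseteq> {..s} \<times> {..s} \<and> length ps = n}"
      using ps by (auto simp: bch_index_def)
  qed
  show "finite {ps. set ps \<subseteq> {..s} \<times> {..s} \<and> length ps = n}"
    by (rule finite_lists_length_eq) simp
qed

definition bch :: "nat \<Rightarrow> ('a \<Rightarrow> 'a \<Rightarrow> 'a) \<Rightarrow> 'a \<Rightarrow> 'a \<Rightarrow> 'a::real_vector" where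
  "bch s br x y =
     (\<Sum>n=1..s. \<Sum>ps\<in>bch_index s n.
        ((-1) ^ (n - 1) / (real n * real (bch_degree ps) * (\<Prod>(p, q)\<leftarrow>ps. fact p * fact q)))
          *\<^sub>R nested_bracket br (bch_word x y ps))"

text \<open>Inversion in exponential coordinates: \<open>exp x\<close> has inverse \<open>exp (- x)\<close>.\<close>

definition group_inv :: "'a::real_vector \<Rightarrow> 'a" where
  "group_inv x = - x"

text \<open>The values at \<open>0\<close> and \<open>1\<close> are conventions; the recursion of interest starts at \<open>2\<close>.\<close>

primrec group_norm ::
  "nat \<Rightarrow> (nat \<Rightarrow> 'a::real_normed_vector set) \<Rightarrow> (nat \<Rightarrow> real) \<Rightarrow> nat \<Rightarrow> 'a \<Rightarrow> real" where
  "group_norm s V lam 0 x = 0"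
| "group_norm s V lam (Suc m) x =
     (if m = 0 then norm (layer s V x 1)
      else if m = 1 then root 4 (norm (layer s V x 1) ^ 4 + lam 2 * norm (layer s V x 2) ^ 2)
      else root (2 * fact (Suc m))
             (group_norm s V lam m x ^ (2 * fact (Suc m))
              + lam (Suc m) * norm (layer s V x (Suc m)) ^ (2 * fact m)))"

definition NH :: "nat \<Rightarrow> ('a \<Rightarrow> 'a \<Rightarrow> 'a) \<Rightarrow> (nat \<Rightarrow> 'a::real_normed_vector set) \<Rightarrow>
    ('a \<Rightarrow> real) \<Rightarrow> 'a \<Rightarrow> real" where
  "NH s br V N g = N (bch s br (group_inv (horizontal s V g)) g)"

end

theory Submission
  imports Defs
begin

text \<open>
  Write \<open>F\<^sub>k = N\<^sub>k ^ (2 k!)\<close>, so that \<open>F\<^sub>1 = |x\<^sub>1|\<^sup>2\<close> and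
  \<open>F\<^sub>k\<^sub>+\<^sub>1 = F\<^sub>k ^ (k + 1) + \<lambda>\<^sub>k\<^sub>+\<^sub>1 |x\<^sub>k\<^sub>+\<^sub>1| ^ (2 k!)\<close>.  The claim is a quantitative midpoint
  convexity of \<open>F\<^sub>s\<close> along the group product, and it is proved by induction on the number of
  layers, choosing \<open>\<lambda>\<^sub>k\<^sub>+\<^sub>1\<close> small after \<open>\<lambda>\<^sub>2, \<dots>, \<lambda>\<^sub>k\<close>.

  Equality can only occur when \<open>g = h\<close> is horizontal.  For the induction the gain has to control
  the distance to that situation more precisely than the inequality of the theorem does.  Let
  \<open>r\<close> be a homogeneous size of the pair \<open>(g, h)\<close> over its first \<open>k\<close> layers, and let \<open>t\<^sub>1 = |g\<^sub>1 - h\<^sub>1|\<close> and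
  \<open>t\<^sub>i = |g\<^sub>i| + |h\<^sub>i|\<close> for \<open>i \<ge> 2\<close>; these are the quantities that vanish for equal horizontal
  elements.  The homogeneous combination \<open>\<eta>\<^sub>k = \<Sum>i\<le>k. r ^ (k - i) t\<^sub>i\<close> of degree \<open>k\<close> is called the
  defect, and the inductive statement (\<open>midpoint_convexity\<close>) is
  \[ F_k(gh) / 2^{2 k!} + C \eta_k^{2 (k-1)!} \le (F_k(g) + F_k(h)) / 2 . \]

  Two facts drive the induction.  First, the degree \<open>k + 1\<close> coordinate of \<open>gh\<close> is
  \<open>g\<^sub>k\<^sub>+\<^sub>1 + h\<^sub>k\<^sub>+\<^sub>1\<close> up to an error \<open>O(r \<eta>\<^sub>k)\<close> (\<open>norm_coord_bch_error_le\<close>), because, once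
  the commutators are expanded into layers, the innermost bracket of each nonzero term either
  contains a coordinate of degree at least 2 or equals \<open>[g\<^sub>1, h\<^sub>1] = [g\<^sub>1 - h\<^sub>1, h\<^sub>1]\<close> up to sign.
  Secondly, raising the inequality for \<open>F\<^sub>k\<close> to the power \<open>k + 1\<close> turns its gain into a multiple of \<open>(r \<eta>\<^sub>k) ^ (2 k!)\<close> (\<open>convexity_gap_lift\<close>).  A small
  \<open>\<lambda>\<^sub>k\<^sub>+\<^sub>1\<close> lets this gain absorb the error, while \<open>\<lambda>\<^sub>k\<^sub>+\<^sub>1 (|g\<^sub>k\<^sub>+\<^sub>1| ^ (2 k!) + |h\<^sub>k\<^sub>+\<^sub>1| ^ (2 k!))\<close> is
  only partly used up and supplies the missing terms of \<open>\<eta>\<^sub>k\<^sub>+\<^sub>1\<close>.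

  Finally \<open>|g\<^sub>1 - h\<^sub>1| ^ (2 s!)\<close> and \<open>NH(gh) ^ (2 s!)\<close> are both bounded by a multiple of
  \<open>\<eta>\<^sub>s ^ (2 (s-1)!)\<close> (\<open>horizontal_difference_le\<close>, \<open>vertical_part_le\<close>,
  \<open>norm_power_le_weighted_sum\<close>).
\<close>

section \<open>Power inequalities\<close>

text \<open>
  The induction step multiplies by \<open>(a + b) / 2\<close> and uses that \<open>a - b\<close> and \<open>a ^ n - b ^ n\<close> have
  the same sign.
\<close>

lemma power_midpoint_le:
  fixes a b :: real
  assumes "0 \<le> a" "0 \<le> b"
  shows "((a + b) / 2) ^ n \<le> (a ^ n + b ^ n) / 2"
proof (induction n)
  case (Suc n)
  have "0 \<le> (a - b) * (a ^ n - b ^ n)"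
    using assms power_mono[of a b n] power_mono[of b a n]
    by (cases "a \<le> b") (simp_all add: mult_nonpos_nonpos)
  then have *: "(a + b) / 2 * ((a ^ n + b ^ n) / 2) \<le> (a ^ Suc n + b ^ Suc n) / 2"
    by (simp add: field_simps)
  have "((a + b) / 2) ^ Suc n \<le> (a + b) / 2 * ((a ^ n + b ^ n) / 2)"
    using Suc assms by (simp only: power_Suc) (intro mult_left_mono, auto)
  with * show ?case by linarith
qed simp

lemma add_power_le:
  fixes a b :: real
  assumes "0 \<le> a" "0 \<le> b"
  shows "(a + b) ^ n \<le> 2 ^ n * (a ^ n + b ^ n)"
proof -
  have "0 \<le> a ^ n" "0 \<le> b ^ n" using assms by auto
  then have "((a + b) / 2) ^ n \<le> a ^ n + b ^ n"
    by (intro order_trans[OF power_midpoint_le[OF assms]]) simp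
  then show ?thesis by (simp add: power_divide field_simps)
qed

text \<open>
  The factor \<open>1/4\<close> is essential: with \<open>a = |g\<^sub>k|\<close>, \<open>b = |h\<^sub>k|\<close> and \<open>c\<close> the commutator error, only half
  of the available \<open>(a ^ n + b ^ n) / 2\<close> is spent on the coordinate of the product.
\<close>

lemma add3_power_le:
  fixes a b c :: real
  assumes "0 \<le> a" "0 \<le> b" "0 \<le> c"
  shows "((a + b + c) / 4) ^ n \<le> (a ^ n + b ^ n) / 4 + c ^ n"
proof -
  have "((a + b + c) / 4) ^ n = (((a + b) / 2 + c / 2) / 2) ^ n"
    by (simp add: field_simps)
  also have "\<dots> \<le> (((a + b) / 2) ^ n + (c / 2) ^ n) / 2"
    using assms by (intro power_midpoint_le) auto
  also have "\<dots> \<le> (a ^ n + b ^ n) / 4 + c ^ n"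
  proof -
    have "(c / 2) ^ n \<le> c ^ n" using assms by (intro power_mono) auto
    moreover have "0 \<le> c ^ n" using assms by simp
    ultimately show ?thesis using power_midpoint_le[OF assms(1,2), of n] by argo
  qed
  finally show ?thesis .
qed

lemma power_gap_ge:
  fixes c d :: real
  assumes "0 \<le> c" "0 \<le> d"
  shows "c ^ Suc n + (c + d) ^ n * d \<le> (c + d) ^ Suc n"
proof -
  have "c * c ^ n \<le> c * (c + d) ^ n"
    using assms by (intro mult_left_mono power_mono) auto
  then show ?thesis by (simp add: algebra_simps)
qed

section \<open>Weighted sums of quantities of different degrees\<close>

text \<open>
  If \<open>t i\<close> has degree \<open>i\<close> and \<open>r\<close> has degree 1, this is the natural quantity of degree \<open>k\<close> that
  is linear in \<open>t\<close>.
\<close>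

definition weighted_sum :: "real \<Rightarrow> (nat \<Rightarrow> real) \<Rightarrow> nat \<Rightarrow> real" where
  "weighted_sum r t k = (\<Sum>i=1..k. r ^ (k - i) * t i)"

lemma weighted_sum_0 [simp]: "weighted_sum r t 0 = 0"
  by (simp add: weighted_sum_def)

lemma weighted_sum_Suc: "weighted_sum r t (Suc k) = r * weighted_sum r t k + t (Suc k)"
  unfolding weighted_sum_def by (simp add: sum_distrib_left Suc_diff_le mult.assoc)

lemma weighted_sum_nonneg: "0 \<le> r \<Longrightarrow> (\<And>i. 0 \<le> t i) \<Longrightarrow> 0 \<le> weighted_sum r t k"
  unfolding weighted_sum_def by (intro sum_nonneg) simp

lemma weighted_sum_mono:
  assumes "0 \<le> r" "r \<le> r'" "\<And>i. 0 \<le> t i" "\<And>i. i \<in> {1..k} \<Longrightarrow> t i \<le> t' i"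
  shows "weighted_sum r t k \<le> weighted_sum r' t' k"
  unfolding weighted_sum_def using assms by (intro sum_mono mult_mono power_mono) auto

lemma weighted_sum_le:
  assumes "0 \<le> r" "\<And>i. i \<in> {1..k} \<Longrightarrow> t i \<le> c * r ^ i"
  shows "weighted_sum r t k \<le> real k * c * r ^ k"
proof -
  have "r ^ (k - i) * t i \<le> c * r ^ k" if "i \<in> {1..k}" for i
  proof -
    have "r ^ (k - i) * t i \<le> r ^ (k - i) * (c * r ^ i)"
      using assms that by (intro mult_left_mono) auto
    also have "\<dots> = c * r ^ k"
      using that by (simp flip: power_add)
    finally show ?thesis .
  qed
  then have "weighted_sum r t k \<le> (\<Sum>i=1..k. c * r ^ k)"
    unfolding weighted_sum_def by (rule sum_mono)
  then show ?thesis by simp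
qed

lemma term_le_weighted_sum:
  assumes "0 \<le> r" "\<And>i. 0 \<le> t i" "i \<in> {1..k}"
  shows "r ^ (k - i) * t i \<le> weighted_sum r t k"
  unfolding weighted_sum_def using assms
  by (intro member_le_sum[of i "{1..k}" "\<lambda>i. r ^ (k - i) * t i"]) auto

lemma power_mult_weighted_sum_le:
  assumes "0 \<le> r" "\<And>i. 0 \<le> t i"
  shows "r ^ i * weighted_sum r t k \<le> weighted_sum r t (k + i)"
proof (induction i)
  case (Suc i)
  then have "r * (r ^ i * weighted_sum r t k) \<le> r * weighted_sum r t (k + i)"
    using assms by (intro mult_left_mono)
  also have "\<dots> \<le> weighted_sum r t (k + Suc i)"
    using assms by (simp add: weighted_sum_Suc)
  finally show ?case by (simp add: mult.assoc)
qed simp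

text \<open>
  Summing weighted sums again, with another scale comparable to \<open>r\<close>, gives nothing new: this
  allows commutator estimates to be iterated.
\<close>

lemma weighted_sum_scale_le:
  assumes "0 \<le> r" "1 \<le> D" "0 \<le> c" "\<And>i. 0 \<le> t i"
    and t': "\<And>i. i \<in> {1..k} \<Longrightarrow> t' i \<le> c * weighted_sum r t i"
  shows "weighted_sum (D * r) t' k \<le> real k * (D ^ k * c) * weighted_sum r t k"
proof -
  have "(D * r) ^ (k - i) * t' i \<le> D ^ k * c * weighted_sum r t k" if i: "i \<in> {1..k}" for i
  proof -
    have "(D * r) ^ (k - i) * t' i \<le> (D * r) ^ (k - i) * (c * weighted_sum r t i)"
      using assms i by (intro mult_left_mono) auto
    also have "\<dots> = D ^ (k - i) * c * (r ^ (k - i) * weighted_sum r t i)"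
      by (simp add: power_mult_distrib)
    also have "\<dots> \<le> D ^ k * c * weighted_sum r t k"
      using assms i power_mult_weighted_sum_le[of r t "k - i" i]
      by (intro mult_mono power_increasing) (auto intro!: weighted_sum_nonneg mult_nonneg_nonneg)
    finally show ?thesis .
  qed
  then have "weighted_sum (D * r) t' k \<le> (\<Sum>i=1..k. D ^ k * c * weighted_sum r t k)"
    unfolding weighted_sum_def[of "D * r"] by (rule sum_mono)
  then show ?thesis by simp
qed

section \<open>Layers\<close>

context graded_lie_algebra
begin

abbreviation coord :: "'a \<Rightarrow> nat \<Rightarrow> 'a" where "coord x j \<equiv> layer s V x j"

lemma decomposition_layer: "decomposition s V x (layer s V x)"
  unfolding layer_def by (rule theI'[OF direct_sum])

lemma layer_eqI: "decomposition s V x v \<Longrightarrow> layer s V x = v"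
  using direct_sum decomposition_layer by blast

lemma coord_in: "j \<in> {1..s} \<Longrightarrow> coord x j \<in> V j"
  using decomposition_layer[of x] by (simp add: decomposition_def)

lemma coord_out: "j \<notin> {1..s} \<Longrightarrow> coord x j = 0"
  using decomposition_layer[of x] by (simp add: decomposition_def)

lemma sum_coord: "(\<Sum>j=1..s. coord x j) = x"
  using decomposition_layer[of x] by (simp add: decomposition_def)

lemma coord_add: "coord (x + y) j = coord x j + coord y j"
proof -
  have "decomposition s V (x + y) (\<lambda>j. coord x j + coord y j)"
    unfolding decomposition_def
    by (auto simp: coord_in coord_out sum.distrib sum_coord[unfolded One_nat_def]
        intro!: subspace_add layer_subspace)
  from layer_eqI[OF this] show ?thesis by simp
qed

lemma coord_scale: "coord (c *\<^sub>R x) j = c *\<^sub>R coord x j"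
proof -
  have "decomposition s V (c *\<^sub>R x) (\<lambda>j. c *\<^sub>R coord x j)"
    unfolding decomposition_def
    by (auto simp: coord_in coord_out sum_coord[unfolded One_nat_def] simp flip: scaleR_sum_right
        intro!: subspace_scale layer_subspace)
  from layer_eqI[OF this] show ?thesis by simp
qed

lemma coord_zero [simp]: "coord 0 j = 0"
  using coord_scale[of 0 0 j] by simp

lemma coord_minus: "coord (- x) j = - coord x j"
  using coord_scale[of "-1" x j] by simp

lemma coord_sum: "coord (sum f A) j = (\<Sum>a\<in>A. coord (f a) j)"
  by (induction A rule: infinite_finite_induct) (auto simp: coord_add)

lemma coord_horizontal:
  assumes "1 \<le> s"
  shows "coord (horizontal s V x) j = (if j = 1 then coord x 1 else 0)"
proof -
  have "decomposition s V (horizontal s V x) (\<lambda>j. if j = 1 then coord x 1 else 0)"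
    using assms coord_in[of 1 x] subspace_0[OF layer_subspace]
    by (auto simp: decomposition_def horizontal_def)
  from layer_eqI[OF this] show ?thesis by simp
qed

lemma br_sum: "br (sum f A) (sum g B) = (\<Sum>a\<in>A. \<Sum>b\<in>B. br (f a) (g b))"
  using bilinear by (simp add: bilinear_sum sum.cartesian_product)

text \<open>
  Summands of degree above \<open>s\<close> in the expansion of the bracket lie in zero layers, so sorting the
  remaining ones by degree is the decomposition of the bracket.
\<close>

lemma coord_br:
  assumes "j \<le> s"
  shows "coord (br a b) j = (\<Sum>i\<in>{1..<j}. br (coord a i) (coord b (j - i)))"
proof -
  let ?f = "\<lambda>(i, l). br (coord a i) (coord b l)"
  let ?v = "\<lambda>j. if j \<in> {1..s} then \<Sum>i\<in>{1..<j}. br (coord a i) (coord b (j - i)) else 0"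
  have "br a b = (\<Sum>p\<in>{1..s} \<times> {1..s}. ?f p)"
    using br_sum[of "coord a" "{1..s}" "coord b" "{1..s}"]
    by (simp add: sum_coord sum_coord[unfolded One_nat_def] sum.cartesian_product)
  also have "\<dots> = (\<Sum>p\<in>{p\<in>{1..s} \<times> {1..s}. fst p + snd p \<le> s}. ?f p)"
  proof (rule sum.mono_neutral_right)
    show "\<forall>p\<in>{1..s} \<times> {1..s} - {p\<in>{1..s} \<times> {1..s}. fst p + snd p \<le> s}. ?f p = 0"
    proof
      fix p assume p: "p \<in> {1..s} \<times> {1..s} - {p\<in>{1..s} \<times> {1..s}. fst p + snd p \<le> s}"
      then have "?f p \<in> V (fst p + snd p)"
        by (auto simp: case_prod_beta intro!: grading coord_in)
      with p layer_trivial[of "fst p + snd p"] show "?f p = 0" by auto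
    qed
  qed auto
  also have "\<dots> = (\<Sum>q\<in>(SIGMA j:{1..s}. {1..<j}). br (coord a (snd q)) (coord b (fst q - snd q)))"
    by (rule sum.reindex_bij_witness[where i = "\<lambda>(j, i). (i, j - i)" and j = "\<lambda>(i, l). (i + l, i)"])
      auto
  also have "\<dots> = (\<Sum>j\<in>{1..s}. ?v j)"
    by (simp add: sum.Sigma case_prod_beta)
  finally have eq: "br a b = (\<Sum>j\<in>{1..s}. ?v j)" .
  have "?v j \<in> V j" if "j \<in> {1..s}" for j
  proof -
    have "br (coord a i) (coord b (j - i)) \<in> V j" if "i \<in> {1..<j}" for i
      using grading[of i "j - i" "coord a i" "coord b (j - i)"] coord_in[of i a]
        coord_in[of "j - i" b] that \<open>j \<in> {1..s}\<close> by auto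
    then show ?thesis using that by (auto intro!: subspace_sum layer_subspace)
  qed
  with eq have "decomposition s V (br a b) ?v"
    by (auto simp: decomposition_def)
  from fun_cong[OF layer_eqI[OF this], of j] assms show ?thesis
    by auto
qed

text \<open>
  Chosen at least 1, so that its powers increase with the length of a bracket.
\<close>

definition bracket_bound :: real where
  "bracket_bound = (SOME B. 1 \<le> B \<and> (\<forall>a b. norm (br a b) \<le> B * norm a * norm b))"

lemma bracket_bound:
  shows bracket_bound_ge_1: "1 \<le> bracket_bound"
    and norm_br_le: "norm (br a b) \<le> bracket_bound * norm a * norm b"
proof -
  from bilinear obtain K where K: "\<And>a b. norm (br a b) \<le> norm a * norm b * K"
    unfolding bilinear_conv_bounded_bilinear using bounded_bilinear.pos_bounded by blast
  have "norm (br a b) \<le> max 1 K * norm a * norm b" for a b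
  proof -
    have "norm a * norm b * K \<le> norm a * norm b * max 1 K"
      by (intro mult_left_mono) auto
    with K[of a b] show ?thesis by (simp add: mult_ac)
  qed
  then have "1 \<le> max 1 K \<and> (\<forall>a b. norm (br a b) \<le> max 1 K * norm a * norm b)" by simp
  from someI[of "\<lambda>B. 1 \<le> B \<and> (\<forall>a b. norm (br a b) \<le> B * norm a * norm b)", OF this]
  show "1 \<le> bracket_bound" "norm (br a b) \<le> bracket_bound * norm a * norm b"
    by (auto simp: bracket_bound_def)
qed

lemma br_antisym: "br a b = - br b a"
proof -
  have "0 = br (a + b) (a + b)" by (simp only: alternating)
  also have "\<dots> = br a b + br b a"
    using bilinear by (simp add: bilinear_ladd bilinear_radd alternating[of a] alternating[of b])
  finally show ?thesis by (simp add: eq_neg_iff_add_eq_0)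
qed

section \<open>The Baker-Campbell-Hausdorff product, layer by layer\<close>

text \<open>
  The scale \<open>r\<close> bounds all coordinates homogeneously, while \<open>t\<close> bounds what is small: coordinates of
  degree at least 2 and brackets of two horizontal coordinates.  Each term of the innermost bracket has
  a factor of the second kind, which yields \<open>r * weighted_sum r t (j - 1)\<close>; each further letter only contributes
  powers of \<open>r\<close>.  Layer \<open>j\<close> involves letters of degree below \<open>j\<close> only, which is why the hypotheses
  stop before \<open>k\<close> and the weighted sum stops at \<open>j - 1\<close>.
\<close>

lemma norm_coord_nested_bracket_le:
  assumes r: "0 \<le> r" and t: "\<And>i. 0 \<le> t i" and k: "k \<le> s"
    and M: "1 \<le> M" "bracket_bound * real s \<le> M"
    and small: "\<And>a i. a \<in> A \<Longrightarrow> i \<in> {1..<k} \<Longrightarrow> norm (coord a i) \<le> r ^ i"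
    and vert: "\<And>a i. a \<in> A \<Longrightarrow> i \<in> {2..<k} \<Longrightarrow> norm (coord a i) \<le> t i"
    and hor: "\<And>a b. a \<in> A \<Longrightarrow> b \<in> A \<Longrightarrow>
      norm (br (coord a 1) (coord b 1)) \<le> bracket_bound * (r * t 1)"
    and w: "set w \<subseteq> A" "2 \<le> length w" and j: "j \<le> k"
  shows "norm (coord (nested_bracket br w) j) \<le> M ^ length w * (r * weighted_sum r t (j - 1))"
  using w j
proof (induction w arbitrary: j)
  case (Cons a w)
  let ?W = "weighted_sum r t"
  let ?B = "bracket_bound"
  have B: "1 \<le> ?B" by (rule bracket_bound_ge_1)
  have W: "0 \<le> ?W i" for i using r t by (rule weighted_sum_nonneg)
  have a: "a \<in> A" using Cons by simp
  obtain b w' where w: "w = b # w'" using Cons by (cases w) auto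
  then have nb: "nested_bracket br (a # w) = br a (nested_bracket br w)" by simp
  let ?c = "nested_bracket br w"
  have js: "j \<le> s" using Cons k by simp
  have *: "norm (br (coord a i) (coord ?c (j - i))) \<le> ?B * (M ^ length w * (r * ?W (j - 1)))"
    if i: "i \<in> {1..<j}" for i
  proof (cases w')
    case Nil
    with w have c: "?c = b" and b: "b \<in> A" using Cons by auto
    \<comment> \<open>Innermost bracket: both letters horizontal, or one of them of degree at least 2.\<close>
    consider "i = 1" "j - i = 1" | "2 \<le> i" | "2 \<le> j - i" using i by force
    then have "norm (br (coord a i) (coord b (j - i))) \<le> ?B * (r * ?W (j - 1))"
    proof cases
      case 1
      then have "j - 1 = Suc 0" by simp
      with 1 hor[OF a b] show ?thesis by (simp add: weighted_sum_Suc)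
    next
      case 2
      have "norm (br (coord a i) (coord b (j - i))) \<le> ?B * (norm (coord a i) * norm (coord b (j - i)))"
        using norm_br_le by (simp add: mult.assoc)
      also have "\<dots> \<le> ?B * (t i * r ^ (j - i))"
        using 2 i B t Cons.prems by (intro mult_left_mono mult_mono vert[OF a] small[OF b]) auto
      also have "t i * r ^ (j - i) = r * (r ^ (j - 1 - i) * t i)"
        using i by (simp flip: power_Suc mult.assoc add: Suc_diff_Suc)
      also have "?B * (r * (r ^ (j - 1 - i) * t i)) \<le> ?B * (r * ?W (j - 1))"
        using B r t i by (intro mult_left_mono term_le_weighted_sum) auto
      finally show ?thesis .
    next
      case 3
      let ?l = "j - i"
      have "norm (br (coord a i) (coord b ?l)) \<le> ?B * (norm (coord a i) * norm (coord b ?l))"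
        using norm_br_le by (simp add: mult.assoc)
      also have "\<dots> \<le> ?B * (r ^ i * t ?l)"
        using 3 i B t r Cons.prems by (intro mult_left_mono mult_mono vert[OF b] small[OF a]) auto
      also have "r ^ i * t ?l = r * (r ^ (j - 1 - ?l) * t ?l)"
      proof -
        have "i = Suc (j - 1 - ?l)" using i by auto
        then have "r ^ i = r * r ^ (j - 1 - ?l)" by (metis power_Suc)
        then show ?thesis by simp
      qed
      also have "?B * (r * (r ^ (j - 1 - ?l) * t ?l)) \<le> ?B * (r * ?W (j - 1))"
        using B r t i 3 by (intro mult_left_mono term_le_weighted_sum) auto
      finally show ?thesis .
    qed
    moreover have "?B * (r * ?W (j - 1)) \<le> ?B * (M ^ length w * (r * ?W (j - 1)))"
    proof (rule mult_left_mono)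
      have "1 * (r * ?W (j - 1)) \<le> M ^ length w * (r * ?W (j - 1))"
        using M r W by (intro mult_right_mono) auto
      then show "r * ?W (j - 1) \<le> M ^ length w * (r * ?W (j - 1))" by simp
    qed (use B in simp)
    ultimately show ?thesis unfolding c by linarith
  next
    case (Cons c w'')
    have IH: "norm (coord ?c (j - i)) \<le> M ^ length w * (r * ?W (j - i - 1))"
      using Cons.IH[of "j - i"] Cons.prems w \<open>w' = c # w''\<close> by auto
    have "norm (br (coord a i) (coord ?c (j - i)))
        \<le> ?B * (norm (coord a i) * norm (coord ?c (j - i)))"
      using norm_br_le by (simp add: mult.assoc)
    also have "\<dots> \<le> ?B * (r ^ i * (M ^ length w * (r * ?W (j - i - 1))))"
      using IH i B r W M Cons.prems by (intro mult_left_mono mult_mono small[OF a]) auto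
    also have "\<dots> = ?B * (M ^ length w * (r * (r ^ i * ?W (j - i - 1))))"
      by (simp add: mult_ac)
    also have "\<dots> \<le> ?B * (M ^ length w * (r * ?W (j - 1)))"
      using power_mult_weighted_sum_le[of r t i "j - i - 1"] r t B M i
      by (intro mult_left_mono) auto
    finally show ?thesis .
  qed
  have "norm (coord (nested_bracket br (a # w)) j)
      \<le> (\<Sum>i\<in>{1..<j}. norm (br (coord a i) (coord ?c (j - i))))"
    unfolding nb coord_br[OF js] by (rule norm_sum)
  also have "\<dots> \<le> (\<Sum>i\<in>{1..<j}. ?B * (M ^ length w * (r * ?W (j - 1))))"
    by (intro sum_mono *)
  also have "\<dots> = (?B * real (j - 1)) * (M ^ length w * (r * ?W (j - 1)))"
    by simp
  also have "\<dots> \<le> M * (M ^ length w * (r * ?W (j - 1)))"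
  proof (rule mult_right_mono)
    have "?B * real (j - 1) \<le> ?B * real s"
      using B js by (intro mult_left_mono) auto
    with M show "?B * real (j - 1) \<le> M" by simp
  qed (use M r W in simp)
  finally show ?case by (simp add: mult.assoc)
qed simp

definition bch_coeff :: "(nat \<times> nat) list \<Rightarrow> real" where
  "bch_coeff ps = (-1) ^ (length ps - 1) /
     (real (length ps) * real (bch_degree ps) * (\<Prod>(p, q)\<leftarrow>ps. fact p * fact q))"

text \<open>
  The indices of all terms of the series except the linear ones \<open>x\<close> and \<open>y\<close>.
\<close>

definition bch_commutators :: "(nat \<times> nat) list set" where
  "bch_commutators = (\<Union>n\<in>{1..s}. bch_index s n) \<inter> {ps. 2 \<le> bch_degree ps}"

lemma finite_bch_commutators: "finite bch_commutators"
  unfolding bch_commutators_def by (auto intro: finite_bch_index)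

lemma length_bch_word: "length (bch_word x y ps) = bch_degree ps"
  by (induction ps) (auto simp: bch_word_def bch_degree_def)

lemma set_bch_word: "set (bch_word x y ps) \<subseteq> {x, y}"
proof
  fix z assume "z \<in> set (bch_word x y ps)"
  then obtain pq where "z \<in> set ((\<lambda>(p, q). replicate p x @ replicate q y) pq)"
    unfolding bch_word_def set_concat set_map by blast
  then show "z \<in> {x, y}" by (cases pq) (auto simp: set_replicate_conv_if split: if_splits)
qed

lemma bch_linear_terms:
  assumes "1 \<le> s"
  shows "(\<Union>n\<in>{1..s}. bch_index s n) = insert [(1, 0)] (insert [(0, 1)] bch_commutators)"
    (is "?I = _")
proof -
  have "ps = [(1, 0)] \<or> ps = [(0, 1)]" if "ps \<in> ?I" "bch_degree ps < 2" for ps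
  proof -
    from that obtain p q qs where ps: "ps = (p, q) # qs" "0 < p + q"
      by (cases ps) (auto simp: bch_index_def)
    have qs: "qs = []"
    proof (cases qs)
      case (Cons a qs')
      then have "0 < fst a + snd a" using that ps by (auto simp: bch_index_def)
      with ps Cons that(2) show ?thesis by (auto simp: bch_degree_def case_prod_beta)
    qed simp
    with ps that(2) have "p + q = 1" by (auto simp: bch_degree_def)
    then have "p = 1 \<and> q = 0 \<or> p = 0 \<and> q = 1" by arith
    with ps qs show ?thesis by auto
  qed
  moreover have "[(1, 0)] \<in> ?I" "[(0, 1)] \<in> ?I"
    using assms by (auto simp: bch_index_def bch_degree_def intro!: bexI[of _ 1])
  ultimately show ?thesis unfolding bch_commutators_def by force
qed

text \<open>
  All later estimates see the product only in this form: the linear part, plus fixed multiples of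
  brackets of at least two letters.
\<close>

lemma bch_eq:
  assumes "1 \<le> s"
  shows "bch s br x y = x + y +
    (\<Sum>ps\<in>bch_commutators. bch_coeff ps *\<^sub>R nested_bracket br (bch_word x y ps))"
proof -
  let ?f = "\<lambda>ps. bch_coeff ps *\<^sub>R nested_bracket br (bch_word x y ps)"
  have "bch s br x y = (\<Sum>n=1..s. \<Sum>ps\<in>bch_index s n. ?f ps)"
    unfolding bch_def by (intro sum.cong refl) (auto simp: bch_coeff_def bch_index_def)
  also have "\<dots> = (\<Sum>ps\<in>(\<Union>n\<in>{1..s}. bch_index s n). ?f ps)"
    by (rule sum.UNION_disjoint[symmetric]) (auto simp: finite_bch_index, auto simp: bch_index_def)
  also have "\<dots> = ?f [(1, 0)] + (?f [(0, 1)] + (\<Sum>ps\<in>bch_commutators. ?f ps))"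
    unfolding bch_linear_terms[OF assms] using finite_bch_commutators
    by (subst sum.insert; simp add: bch_commutators_def bch_degree_def)+
  also have "?f [(1, 0)] = x" by (simp add: bch_coeff_def bch_degree_def bch_word_def)
  also have "?f [(0, 1)] = y" by (simp add: bch_coeff_def bch_degree_def bch_word_def)
  finally show ?thesis by (simp add: add.assoc)
qed

definition bch_bound :: real where
  "bch_bound = 1 + (\<Sum>ps\<in>bch_commutators. \<bar>bch_coeff ps\<bar> * (bracket_bound * real s) ^ bch_degree ps)"

lemma bch_bound_ge_1: "1 \<le> bch_bound"
  unfolding bch_bound_def using bracket_bound_ge_1 by (auto intro!: sum_nonneg)

text \<open>
  The hypothesis on horizontal brackets is stated separately because it holds for two different
  reasons: for a pair \<open>g, h\<close> since \<open>g\<^sub>1 - h\<^sub>1\<close> is small, and for the pair \<open>- x\<^sub>1, x\<close> since the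
  bracket vanishes.
\<close>

lemma norm_coord_bch_le:
  assumes r: "0 \<le> r" and t: "\<And>i. 0 \<le> t i" and k: "1 \<le> k" "k \<le> s"
    and small: "\<And>i. i \<in> {1..<k} \<Longrightarrow> norm (coord x i) \<le> r ^ i \<and> norm (coord y i) \<le> r ^ i"
    and vert: "\<And>i. i \<in> {2..<k} \<Longrightarrow> norm (coord x i) \<le> t i \<and> norm (coord y i) \<le> t i"
    and hor: "norm (br (coord x 1) (coord y 1)) \<le> bracket_bound * (r * t 1)"
  shows "norm (coord (bch s br x y) k - coord x k - coord y k)
    \<le> bch_bound * (r * weighted_sum r t (k - 1))"
proof -
  let ?W = "r * weighted_sum r t (k - 1)"
  have W: "0 \<le> ?W" using r t by (simp add: weighted_sum_nonneg)
  have M: "1 \<le> bracket_bound * real s"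
    using mult_mono[of 1 bracket_bound 1 "real s"] bracket_bound_ge_1 k by simp
  have word: "norm (coord (nested_bracket br (bch_word x y ps)) k)
      \<le> (bracket_bound * real s) ^ bch_degree ps * ?W" if "ps \<in> bch_commutators" for ps
    unfolding length_bch_word[symmetric, of ps x y]
  proof (rule norm_coord_nested_bracket_le[where A = "{x, y}" and k = k])
    show "2 \<le> length (bch_word x y ps)"
      using that by (simp add: length_bch_word bch_commutators_def)
    show "norm (br (coord a 1) (coord b 1)) \<le> bracket_bound * (r * t 1)"
      if "a \<in> {x, y}" "b \<in> {x, y}" for a b
    proof -
      have "norm (br (coord y 1) (coord x 1)) \<le> bracket_bound * (r * t 1)"
        using hor by (subst br_antisym) simp
      moreover have "0 \<le> bracket_bound * (r * t 1)"
        using bracket_bound_ge_1 r t by simp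
      ultimately show ?thesis using that hor by (auto simp: alternating)
    qed
  qed (use r t k small vert M set_bch_word[of x y ps] in auto)
  have "coord (bch s br x y) k - coord x k - coord y k
      = (\<Sum>ps\<in>bch_commutators. bch_coeff ps *\<^sub>R coord (nested_bracket br (bch_word x y ps)) k)"
    using k by (simp add: bch_eq coord_add coord_sum coord_scale)
  also have "norm \<dots> \<le> (\<Sum>ps\<in>bch_commutators.
      \<bar>bch_coeff ps\<bar> * norm (coord (nested_bracket br (bch_word x y ps)) k))"
    by (rule order_trans[OF norm_sum]) simp
  also have "\<dots> \<le> (\<Sum>ps\<in>bch_commutators.
      \<bar>bch_coeff ps\<bar> * ((bracket_bound * real s) ^ bch_degree ps * ?W))"
    by (intro sum_mono mult_left_mono word) auto
  also have "\<dots> = (bch_bound - 1) * ?W"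
    unfolding bch_bound_def by (simp add: sum_distrib_right mult.assoc)
  also have "\<dots> \<le> bch_bound * ?W"
    using W by (intro mult_right_mono) auto
  finally show ?thesis .
qed

lemma coord_bch_1:
  assumes "1 \<le> s"
  shows "coord (bch s br x y) 1 = coord x 1 + coord y 1"
proof -
  \<comment> \<open>In degree 1 the weighted sum is empty, so any admissible \<open>r\<close> and \<open>t\<close> force the error to be 0.\<close>
  have "norm (br (coord x 1) (coord y 1)) \<le> bracket_bound * norm (br (coord x 1) (coord y 1))"
    using mult_right_mono[OF bracket_bound_ge_1, of "norm (br (coord x 1) (coord y 1))"] by simp
  then have "norm (coord (bch s br x y) 1 - coord x 1 - coord y 1) \<le> 0"
    using norm_coord_bch_le[of 1 "\<lambda>_. norm (br (coord x 1) (coord y 1))" 1 x y] assms by simp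
  then show ?thesis by (simp add: algebra_simps)
qed

section \<open>Size and defect of a pair\<close>

definition spread :: "'a \<Rightarrow> 'a \<Rightarrow> nat \<Rightarrow> real" where
  "spread g h i =
     (if i = 1 then norm (coord g 1 - coord h 1) else norm (coord g i) + norm (coord h i))"

text \<open>
  The roots make this homogeneous of degree 1 under the dilations of the group.  Only the first
  \<open>k\<close> layers enter, since \<open>F\<^sub>k\<close> controls no more than these.
\<close>

definition size_upto :: "nat \<Rightarrow> 'a \<Rightarrow> 'a \<Rightarrow> real" where
  "size_upto k g h = (\<Sum>j=1..k. root j (norm (coord g j)) + root j (norm (coord h j)))"

abbreviation defect :: "nat \<Rightarrow> 'a \<Rightarrow> 'a \<Rightarrow> real" where
  "defect k g h \<equiv> weighted_sum (size_upto k g h) (spread g h) k"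

lemma spread_nonneg: "0 \<le> spread g h i"
  by (simp add: spread_def)

lemma size_upto_nonneg: "0 \<le> size_upto k g h"
  unfolding size_upto_def by (intro sum_nonneg) (auto intro!: add_nonneg_nonneg real_root_ge_zero)

lemma defect_nonneg: "0 \<le> defect k g h"
  by (intro weighted_sum_nonneg size_upto_nonneg spread_nonneg)

lemma norm_coord_le_size:
  assumes "i \<in> {1..k}"
  shows "norm (coord g i) \<le> size_upto k g h ^ i" "norm (coord h i) \<le> size_upto k g h ^ i"
proof -
  have *: "root i (norm (coord g i)) + root i (norm (coord h i)) \<le> size_upto k g h"
    unfolding size_upto_def using assms
    by (intro member_le_sum[where f = "\<lambda>i. root i (norm (coord g i)) + root i (norm (coord h i))"])
      (auto intro!: add_nonneg_nonneg real_root_ge_zero)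
  have nn: "0 \<le> root i (norm (coord g i))" "0 \<le> root i (norm (coord h i))"
    using assms by (auto intro!: real_root_ge_zero)
  have "root i (norm (coord g i)) ^ i \<le> size_upto k g h ^ i"
       "root i (norm (coord h i)) ^ i \<le> size_upto k g h ^ i"
    using * nn by (intro power_mono; linarith)+
  then show "norm (coord g i) \<le> size_upto k g h ^ i" "norm (coord h i) \<le> size_upto k g h ^ i"
    using assms by simp_all
qed

lemma spread_le_size:
  assumes "i \<in> {1..k}"
  shows "spread g h i \<le> 2 * size_upto k g h ^ i"
proof -
  have "spread g h i \<le> norm (coord g i) + norm (coord h i)"
    by (auto simp: spread_def norm_triangle_ineq4)
  with norm_coord_le_size(1)[OF assms, of g h] norm_coord_le_size(2)[OF assms, of h g]
  show ?thesis by linarith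
qed

lemma weighted_sum_spread_le:
  assumes "m \<le> k"
  shows "weighted_sum (size_upto k g h) (spread g h) m \<le> real m * 2 * size_upto k g h ^ m"
  using assms by (intro weighted_sum_le size_upto_nonneg spread_le_size) auto

text \<open>
  The horizontal bracket is small because \<open>[g\<^sub>1, h\<^sub>1] = [g\<^sub>1 - h\<^sub>1, h\<^sub>1]\<close>.
\<close>

lemma norm_coord_bch_error_le:
  assumes "1 \<le> m" "m < s" "m \<le> k"
  shows "norm (coord (bch s br g h) (Suc m) - coord g (Suc m) - coord h (Suc m))
    \<le> bch_bound * (size_upto k g h * weighted_sum (size_upto k g h) (spread g h) m)"
proof -
  let ?r = "size_upto k g h"
  have "br (coord g 1) (coord h 1) = br (coord g 1 - coord h 1) (coord h 1)"
    using bilinear by (simp add: bilinear_lsub alternating)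
  then have "norm (br (coord g 1) (coord h 1))
      \<le> bracket_bound * (norm (coord g 1 - coord h 1) * norm (coord h 1))"
    using norm_br_le by (simp add: mult.assoc)
  also have "\<dots> \<le> bracket_bound * (norm (coord g 1 - coord h 1) * ?r)"
    using bracket_bound_ge_1 norm_coord_le_size(2)[of 1 k h g] assms
    by (intro mult_left_mono) auto
  also have "\<dots> = bracket_bound * (?r * spread g h 1)"
    by (simp add: spread_def)
  finally have hor: "norm (br (coord g 1) (coord h 1)) \<le> bracket_bound * (?r * spread g h 1)" .
  have "norm (coord (bch s br g h) (Suc m) - coord g (Suc m) - coord h (Suc m))
    \<le> bch_bound * (?r * weighted_sum ?r (spread g h) (Suc m - 1))"
    by (rule norm_coord_bch_le)
      (use assms hor in \<open>auto simp: norm_coord_le_size size_upto_nonneg spread_nonneg spread_def\<close>)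
  then show ?thesis by simp
qed

lemma size_upto_Suc:
  "size_upto (Suc m) g h = size_upto m g h
     + (root (Suc m) (norm (coord g (Suc m))) + root (Suc m) (norm (coord h (Suc m))))"
  unfolding size_upto_def by simp

lemma root_add_power_le:
  assumes "0 \<le> a" "0 \<le> b" "0 < n"
  shows "(root n a + root n b) ^ (n * q) \<le> 2 ^ (n * q) * (a ^ q + b ^ q)"
  using add_power_le[of "root n a" "root n b" "n * q"] assms
  by (simp add: power_mult real_root_ge_zero)

text \<open>
  Passing to the next layer also enlarges the size \<open>r\<close>, by some \<open>d\<close>.  If \<open>d \<le> r\<close> this costs a
  constant factor.  If \<open>r \<le> d\<close>, then the new coordinates dominate everything, because the
  defect never exceeds a multiple of the size to the power \<open>m + 1\<close>.
\<close>

lemma defect_Suc_le: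
  obtains D where "0 < D"
    "\<And>g h. defect (Suc m) g h
      \<le> D * (size_upto m g h * defect m g h + (norm (coord g (Suc m)) + norm (coord h (Suc m))))"
proof
  let ?k = "Suc m"
  define D :: real where "D = 2 * (real m * 2 ^ m) + real ?k * 2 * 4 ^ ?k + 1"
  show "0 < D" by (simp add: D_def add_nonneg_pos)
  fix g h
  let ?r = "size_upto m g h" and ?R = "size_upto ?k g h" and ?t = "spread g h"
  define d where "d = root ?k (norm (coord g ?k)) + root ?k (norm (coord h ?k))"
  let ?v = "norm (coord g ?k) + norm (coord h ?k)"
  have R: "?R = ?r + d" unfolding d_def by (rule size_upto_Suc)
  have r: "0 \<le> ?r" "0 \<le> ?R" by (rule size_upto_nonneg)+
  have tv: "?t ?k \<le> ?v" by (auto simp: spread_def norm_triangle_ineq4)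
  have W: "0 \<le> ?r * defect m g h" using r defect_nonneg by simp
  have v: "0 \<le> ?v" by simp
  consider "d \<le> ?r" | "?r \<le> d" by linarith
  then show "defect ?k g h \<le> D * (?r * defect m g h + ?v)"
  proof cases
    case 1
    have "weighted_sum ?R ?t m \<le> weighted_sum (2 * ?r) ?t m"
      using 1 R r by (intro weighted_sum_mono spread_nonneg) auto
    also have "\<dots> \<le> real m * (2 ^ m * 1) * defect m g h"
    proof (rule weighted_sum_scale_le)
      show "?t i \<le> 1 * weighted_sum ?r ?t i" if "i \<in> {1..m}" for i
        using that r term_le_weighted_sum[of ?r ?t i i] by (simp add: spread_nonneg)
    qed (use r spread_nonneg in auto)
    finally have "?R * weighted_sum ?R ?t m \<le> (2 * ?r) * (real m * 2 ^ m * defect m g h)"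
      using 1 R r by (intro mult_mono weighted_sum_nonneg spread_nonneg) auto
    then have "defect ?k g h \<le> 2 * (real m * 2 ^ m) * (?r * defect m g h) + 1 * ?v"
      using tv by (simp only: weighted_sum_Suc) (simp add: mult_ac)
    also have "\<dots> \<le> D * (?r * defect m g h) + D * ?v"
      using W v by (intro add_mono mult_right_mono) (auto simp: D_def add_nonneg_pos)
    finally show ?thesis by (simp only: distrib_left)
  next
    case 2
    have "?R ^ ?k \<le> (2 * d) ^ ?k"
      using 2 R r by (intro power_mono) auto
    also have "\<dots> \<le> 4 ^ ?k * ?v"
    proof -
      have "d ^ ?k \<le> 2 ^ ?k * ?v"
        using root_add_power_le[of "norm (coord g ?k)" "norm (coord h ?k)" ?k 1]
        by (simp only: d_def mult_1_right power_one_right) simp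
      then have "2 ^ ?k * d ^ ?k \<le> 2 ^ ?k * (2 ^ ?k * ?v)" by (intro mult_left_mono) auto
      moreover have "(4::real) ^ ?k = 2 ^ ?k * 2 ^ ?k" by (simp flip: power_mult_distrib)
      ultimately show ?thesis by (simp only: power_mult_distrib mult.assoc)
    qed
    finally have "real ?k * 2 * ?R ^ ?k \<le> real ?k * 2 * (4 ^ ?k * ?v)"
      by (intro mult_left_mono) auto
    then have "defect ?k g h \<le> (real ?k * 2 * 4 ^ ?k) * ?v"
      using weighted_sum_spread_le[OF order_refl, of ?k g h] by (simp only: mult.assoc)
    also have "\<dots> \<le> D * ?v" using v by (intro mult_right_mono) (auto simp: D_def)
    also have "\<dots> \<le> D * (?r * defect m g h + ?v)"
      using W \<open>0 < D\<close> by (intro mult_left_mono) auto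
    finally show ?thesis .
  qed
qed

section \<open>Powers of the group norm\<close>

abbreviation norm_power :: "(nat \<Rightarrow> real) \<Rightarrow> nat \<Rightarrow> 'a \<Rightarrow> real" where
  "norm_power lam k x \<equiv> group_norm s V lam k x ^ (2 * fact k)"

lemma group_norm_nonneg:
  assumes "\<And>j. 0 \<le> lam j"
  shows "0 \<le> group_norm s V lam k x"
  using assms by (induction k) (auto intro!: real_root_ge_zero add_nonneg_nonneg)

lemma group_norm_cong:
  assumes "\<And>j. j \<le> k \<Longrightarrow> lam j = lam' j"
  shows "group_norm s V lam k x = group_norm s V lam' k x"
  using assms by (induction k) auto

text \<open>
  The first step \<open>m = 1\<close> agrees with the general pattern because \<open>2 * 2! = 4\<close> and \<open>2 * 1! = 2\<close>.
\<close>

lemma norm_power_Suc: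
  assumes lam: "\<And>j. 0 \<le> lam j" and m: "1 \<le> m"
  shows "norm_power lam (Suc m) x
    = norm_power lam m x ^ Suc m + lam (Suc m) * norm (coord x (Suc m)) ^ (2 * fact m)"
proof (cases "m = 1")
  case True
  let ?y = "norm (coord x 1) ^ 4 + lam 2 * norm (coord x 2) ^ 2"
  have "group_norm s V lam (Suc 1) x = root 4 ?y"
    unfolding group_norm.simps(2)[of s V lam 1] by simp
  moreover have "root 4 ?y ^ 4 = ?y"
    using lam[of 2] by (intro real_root_pow_pos2) (auto intro!: add_nonneg_nonneg)
  ultimately show ?thesis using True by (simp add: numeral_2_eq_2[symmetric] flip: power_mult)
next
  case False
  let ?y = "group_norm s V lam m x ^ (2 * fact (Suc m)) + lam (Suc m) * norm (coord x (Suc m)) ^ (2 * fact m)"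
  have "norm_power lam (Suc m) x = root (2 * fact (Suc m)) ?y ^ (2 * fact (Suc m))"
    using False m by simp
  also have "\<dots> = ?y"
    using lam group_norm_nonneg[of lam m x]
    by (intro real_root_pow_pos2) (auto intro!: add_nonneg_nonneg)
  also have "group_norm s V lam m x ^ (2 * fact (Suc m)) = norm_power lam m x ^ Suc m"
  proof -
    have e: "(2 * fact (Suc m) :: nat) = 2 * fact m * Suc m" by simp
    show ?thesis unfolding e by (rule power_mult)
  qed
  finally show ?thesis .
qed

lemma size_power_le_norm_power:
  assumes "1 \<le> k" and lam: "\<And>j. 0 < lam j"
  obtains K where "0 < K"
    "\<And>g h. size_upto k g h ^ (2 * fact k) \<le> K * (norm_power lam k g + norm_power lam k h)"
proof -
  have "\<exists>K>0. \<forall>g h. size_upto k g h ^ (2 * fact k) \<le> K * (norm_power lam k g + norm_power lam k h)"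
    using assms(1)
  proof (induction k rule: nat_induct_at_least)
    case base
    have "size_upto 1 g h ^ (2 * fact 1) \<le> 4 * (norm_power lam 1 g + norm_power lam 1 h)" for g h
      using add_power_le[of "norm (coord g 1)" "norm (coord h 1)" 2]
      by (simp add: size_upto_def)
    then show ?case by (intro exI[of _ 4]) simp
  next
    case (Suc m)
    then obtain K where K: "0 < K"
      "\<And>g h. size_upto m g h ^ (2 * fact m) \<le> K * (norm_power lam m g + norm_power lam m h)"
      by blast
    let ?k = "Suc m" and ?e = "2 * fact m :: nat"
    define l where "l = lam ?k"
    have l: "0 < l" using lam by (simp add: l_def)
    define K' where "K' = 2 ^ (?e * ?k) * max (K ^ ?k * 2 ^ ?k) (2 ^ (?e * ?k) / l)"
    have e: "2 * fact ?k = ?e * ?k" by simp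
    have "size_upto ?k g h ^ (2 * fact ?k) \<le> K' * (norm_power lam ?k g + norm_power lam ?k h)" for g h
    proof -
      let ?a = "norm_power lam m g" and ?b = "norm_power lam m h"
      let ?u = "norm (coord g ?k)" and ?v = "norm (coord h ?k)"
      have ab: "0 \<le> ?a" "0 \<le> ?b"
        using lam by (auto intro!: zero_le_power group_norm_nonneg less_imp_le)
      let ?M = "max (K ^ ?k * 2 ^ ?k) (2 ^ (?e * ?k) / l)"
      have 1: "size_upto m g h ^ (?e * ?k) \<le> ?M * (?a ^ ?k + ?b ^ ?k)"
      proof -
        have "size_upto m g h ^ (?e * ?k) = (size_upto m g h ^ ?e) ^ ?k" by (rule power_mult)
        also have "\<dots> \<le> (K * (?a + ?b)) ^ ?k"
          using K(2) by (intro power_mono) (auto intro!: zero_le_power size_upto_nonneg)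
        also have "\<dots> = K ^ ?k * (?a + ?b) ^ ?k" by (rule power_mult_distrib)
        also have "\<dots> \<le> K ^ ?k * (2 ^ ?k * (?a ^ ?k + ?b ^ ?k))"
          using K(1) ab by (intro mult_left_mono add_power_le) auto
        also have "\<dots> = K ^ ?k * 2 ^ ?k * (?a ^ ?k + ?b ^ ?k)" by (simp only: mult.assoc)
        also have "\<dots> \<le> ?M * (?a ^ ?k + ?b ^ ?k)"
          using ab by (intro mult_right_mono) (auto intro!: add_nonneg_nonneg)
        finally show ?thesis .
      qed
      have 2: "(root ?k ?u + root ?k ?v) ^ (?e * ?k) \<le> ?M * (l * ?u ^ ?e + l * ?v ^ ?e)"
      proof -
        have "(root ?k ?u + root ?k ?v) ^ (?e * ?k) \<le> 2 ^ (?e * ?k) * (?u ^ ?e + ?v ^ ?e)"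
          using root_add_power_le[of ?u ?v ?k ?e] by (simp only: mult.commute) simp
        also have "\<dots> = 2 ^ (?e * ?k) / l * (l * ?u ^ ?e + l * ?v ^ ?e)"
          using l by (simp add: field_simps)
        also have "\<dots> \<le> ?M * (l * ?u ^ ?e + l * ?v ^ ?e)"
          using l by (intro mult_right_mono) auto
        finally show ?thesis .
      qed
      have "size_upto ?k g h ^ (?e * ?k)
          \<le> 2 ^ (?e * ?k) * (size_upto m g h ^ (?e * ?k) + (root ?k ?u + root ?k ?v) ^ (?e * ?k))"
        unfolding size_upto_Suc
        by (intro add_power_le size_upto_nonneg add_nonneg_nonneg real_root_ge_zero) auto
      also have "\<dots> \<le> 2 ^ (?e * ?k) * (?M * (?a ^ ?k + ?b ^ ?k) + ?M * (l * ?u ^ ?e + l * ?v ^ ?e))"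
        using 1 2 by (intro mult_left_mono add_mono) auto
      also have "\<dots> = K' * ((?a ^ ?k + l * ?u ^ ?e) + (?b ^ ?k + l * ?v ^ ?e))"
        unfolding K'_def by (simp only: distrib_left mult.assoc add_ac)
      finally show ?thesis
        unfolding norm_power_Suc[OF less_imp_le[OF lam] Suc.hyps] l_def unfolding e .
    qed
    moreover have "0 < K'" using K(1) l by (auto simp: K'_def less_max_iff_disj)
    ultimately show ?case by blast
  qed
  then show ?thesis using that by blast
qed

text \<open>
  Coordinates of size \<open>\<eta>\<^sub>j\<close> bound \<open>F\<^sub>k(y)\<close> by a multiple of \<open>\<Sum>j. \<eta>\<^sub>j ^ (2 k! / j)\<close>.  The surplus
  powers of \<open>\<eta>\<^sub>j\<close> are traded for powers of \<open>r\<close> through \<open>\<eta>\<^sub>j \<le> 2 j r ^ j\<close>, and \<open>r ^ (k - j) \<eta>\<^sub>j \<le> \<eta>\<^sub>k\<close>.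
\<close>

lemma norm_power_le_weighted_sum:
  assumes "1 \<le> k" and lam: "\<And>j. 0 < lam j" and K: "0 \<le> K"
  obtains K' where "0 < K'"
    "\<And>y r t. \<lbrakk>0 \<le> r; \<And>i. 0 \<le> t i; \<And>i. i \<in> {1..k} \<Longrightarrow> t i \<le> 2 * r ^ i;
       \<And>j. j \<in> {1..k} \<Longrightarrow> norm (coord y j) \<le> K * weighted_sum r t j\<rbrakk>
     \<Longrightarrow> norm_power lam k y \<le> K' * weighted_sum r t k ^ (2 * fact (k - 1))"
proof -
  let ?P = "\<lambda>k K'. \<forall>y r t. 0 \<le> r \<longrightarrow> (\<forall>i. 0 \<le> t i) \<longrightarrow> (\<forall>i\<in>{1..k}. t i \<le> 2 * r ^ i) \<longrightarrow>
       (\<forall>j\<in>{1..k}. norm (coord y j) \<le> K * weighted_sum r t j)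
     \<longrightarrow> norm_power lam k y \<le> K' * weighted_sum r t k ^ (2 * fact (k - 1))"
  have "\<exists>K'>0. ?P k K'"
    using assms(1)
  proof (induction k rule: nat_induct_at_least)
    case base
    have "norm_power lam 1 y \<le> (K\<^sup>2 + 1) * weighted_sum r t 1 ^ (2 * fact (1 - 1))"
      if "\<forall>j\<in>{1..1}. norm (coord y j) \<le> K * weighted_sum r t j" for y r t
    proof -
      have "norm (coord y 1) ^ 2 \<le> (K * weighted_sum r t 1) ^ 2"
        using that by (intro power_mono) auto
      then show ?thesis by (simp add: power_mult_distrib distrib_right add_increasing2)
    qed
    moreover have "0 < K\<^sup>2 + 1" by (simp add: add_nonneg_pos)
    ultimately show ?case by blast
  next
    case (Suc m)
    then obtain K' where K': "0 < K'" "?P m K'" by blast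
    let ?k = "Suc m" and ?e = "2 * fact m :: nat" and ?e' = "2 * fact (m - 1) :: nat"
    define K'' where "K'' = K' ^ ?k * (real m * 2) ^ ?e' + lam ?k * K ^ ?e"
    have em: "?e = m * ?e'" using Suc.hyps by (simp add: fact_reduce)
    have "norm_power lam ?k y \<le> K'' * weighted_sum r t ?k ^ (2 * fact (?k - 1))"
      if r: "0 \<le> r" and t: "\<forall>i. 0 \<le> t i" and tr: "\<forall>i\<in>{1..?k}. t i \<le> 2 * r ^ i"
        and y: "\<forall>j\<in>{1..?k}. norm (coord y j) \<le> K * weighted_sum r t j" for y r t
    proof -
      let ?w = "weighted_sum r t m" and ?w' = "weighted_sum r t ?k"
      have w: "0 \<le> ?w" "0 \<le> ?w'" using r t by (auto intro: weighted_sum_nonneg)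
      have rw: "r * ?w \<le> ?w'" using t by (simp add: weighted_sum_Suc)
      have wr: "?w \<le> real m * 2 * r ^ m" using r tr by (intro weighted_sum_le) auto
      have 1: "norm_power lam m y ^ ?k \<le> K' ^ ?k * (real m * 2) ^ ?e' * ?w' ^ ?e"
      proof -
        have "norm_power lam m y ^ ?k \<le> (K' * ?w ^ ?e') ^ ?k"
          using K'(2) r t tr y lam by (intro power_mono)
            (auto intro!: zero_le_power group_norm_nonneg less_imp_le)
        also have "\<dots> = K' ^ ?k * (?w ^ ?e * ?w ^ ?e')"
          unfolding em by (simp add: power_mult_distrib mult.commute flip: power_mult power_add)
        also have "\<dots> \<le> K' ^ ?k * (?w ^ ?e * (real m * 2 * r ^ m) ^ ?e')"
          using K'(1) w wr by (intro mult_left_mono power_mono) auto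
        also have "\<dots> = K' ^ ?k * (real m * 2) ^ ?e' * (r * ?w) ^ ?e"
          unfolding em by (simp add: power_mult_distrib mult_ac flip: power_mult)
        also have "\<dots> \<le> K' ^ ?k * (real m * 2) ^ ?e' * ?w' ^ ?e"
          using K'(1) w r rw by (intro mult_left_mono power_mono) auto
        finally show ?thesis .
      qed
      have 2: "lam ?k * norm (coord y ?k) ^ ?e \<le> lam ?k * K ^ ?e * ?w' ^ ?e"
      proof -
        have "norm (coord y ?k) ^ ?e \<le> (K * ?w') ^ ?e" using y by (intro power_mono) auto
        then show ?thesis using lam[of ?k] by (simp add: power_mult_distrib mult.assoc)
      qed
      show ?thesis
        unfolding norm_power_Suc[OF less_imp_le[OF lam] Suc.hyps] K''_def diff_Suc_1
        using 1 2 by (simp only: distrib_right)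
    qed
    moreover have "0 < K''"
      using K'(1) K lam[of ?k] Suc.hyps by (simp add: K''_def add_pos_nonneg)
    ultimately show ?case by blast
  qed
  then obtain K' where "0 < K'" "?P k K'" by blast
  then show ?thesis using that[of K'] by simp
qed

section \<open>Uniform convexity with a defect term\<close>

text \<open>
  The mean \<open>(a + b) / 2\<close> is \<open>c\<close> plus the gap; \<open>power_gap_ge\<close> raises this to a power, and convexity
  of the power compares the result with \<open>a\<close> and \<open>b\<close>.
\<close>

lemma convexity_gap_lift:
  fixes a b c :: real
  assumes "0 \<le> c" "0 \<le> a" "0 \<le> b" "c \<le> (a + b) / 2"
  shows "c ^ Suc n + ((a + b) / 2) ^ n * ((a + b) / 2 - c) \<le> (a ^ Suc n + b ^ Suc n) / 2"
  using power_gap_ge[of c "(a + b) / 2 - c" n] power_midpoint_le[of a b "Suc n"] assms by simp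

text \<open>
  The base case is the parallelogram law for \<open>g\<^sub>1\<close> and \<open>h\<^sub>1\<close>.  In the step, with \<open>e = 2 m!\<close>, the
  inductive gap \<open>C \<eta> ^ (2 (m-1)!)\<close> times \<open>((a + b) / 2) ^ m\<close> is at least \<open>\<kappa> (r \<eta>) ^ e\<close>, since
  \<open>r ^ e\<close> is bounded by \<open>a + b\<close> and \<open>\<eta>\<close> by \<open>r ^ m\<close>.  Here \<open>\<kappa>\<close> is independent of the new
  weight \<open>l\<close>, so \<open>l\<close> can be chosen to make the commutator error cost at most half of it.
\<close>

lemma midpoint_convexity:
  assumes "1 \<le> k" "k \<le> s"
  obtains lam C where "\<And>j. 0 < lam j" "0 < C"
    "\<And>g h. norm_power lam k (bch s br g h) / 2 ^ (2 * fact k) + C * defect k g h ^ (2 * fact (k - 1))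
      \<le> (norm_power lam k g + norm_power lam k h) / 2"
proof -
  let ?P = "\<lambda>k lam C. (\<forall>j. 0 < lam j) \<and> 0 < C \<and>
    (\<forall>g h. norm_power lam k (bch s br g h) / 2 ^ (2 * fact k) + C * defect k g h ^ (2 * fact (k - 1))
      \<le> (norm_power lam k g + norm_power lam k h) / 2)"
  have "\<exists>lam C. ?P k lam C" using assms
  proof (induction k rule: nat_induct_at_least)
    case base
    have "norm (coord (bch s br g h) 1)^2 / 4 + 1/4 * norm (coord g 1 - coord h 1)^2
        \<le> (norm (coord g 1)^2 + norm (coord h 1)^2) / 2" for g h
      unfolding coord_bch_1[OF base]
      by (simp add: power2_norm_eq_inner inner_simps inner_commute field_simps)
    then have "?P 1 (\<lambda>_. 1) (1/4)"
      by (simp add: weighted_sum_def spread_def)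
    then show ?case by (intro exI[of _ "\<lambda>_. 1"] exI[of _ "1/4"])
  next
    case (Suc m)
    then obtain lam C where lam: "\<And>j. 0 < lam j" and C: "0 < C" and IH:
      "\<And>g h. norm_power lam m (bch s br g h) / 2 ^ (2 * fact m) + C * defect m g h ^ (2 * fact (m - 1))
      \<le> (norm_power lam m g + norm_power lam m h) / 2" by auto
    obtain K where K: "0 < K"
      "\<And>g h. size_upto m g h ^ (2 * fact m) \<le> K * (norm_power lam m g + norm_power lam m h)"
      using size_power_le_norm_power[OF Suc.hyps, of lam] lam by blast
    obtain D where D: "0 < D"
      "\<And>g h. defect (Suc m) g h
        \<le> D * (size_upto m g h * defect m g h + (norm (coord g (Suc m)) + norm (coord h (Suc m))))"
      using defect_Suc_le by blast
    let ?k = "Suc m" and ?e = "2 * fact m :: nat" and ?e' = "2 * fact (m - 1) :: nat"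
    have em: "?e = m * ?e'" using Suc.hyps by (simp add: fact_reduce)
    have ek: "2 * fact ?k = ?e * ?k" by simp
    \<comment> \<open>\<open>c0\<close> comes from trading \<open>\<eta> ^ ((m - 1) * e')\<close>, where \<open>\<eta> \<le> 2 m r ^ m\<close>, for powers of \<open>r\<close>.\<close>
    define c0 where "c0 = (real m * 2) ^ ((m - 1) * ?e')"
    define \<kappa> where "\<kappa> = C / ((2 * K) ^ m * c0)"
    \<comment> \<open>With this weight the error \<open>bch_bound * (r * \<eta>)\<close> costs exactly \<open>\<kappa> / 2\<close>.\<close>
    define l where "l = \<kappa> / (2 * bch_bound ^ ?e)"
    define \<mu> where "\<mu> = min (\<kappa> / 2) (l / 4)"
    define C' where "C' = \<mu> / (4 * D) ^ ?e"
    define lam' where "lam' = lam(?k := l)"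
    have c0: "0 < c0" using Suc.hyps by (simp add: c0_def)
    have \<kappa>: "0 < \<kappa>" using C K(1) c0 by (simp add: \<kappa>_def)
    have l: "0 < l" using \<kappa> bch_bound_ge_1 by (simp add: l_def)
    have \<mu>: "0 < \<mu>" using \<kappa> l by (simp add: \<mu>_def)
    have C': "0 < C'" using \<mu> D(1) by (simp add: C'_def)
    have lam': "0 < lam' j" for j using lam l by (simp add: lam'_def)
    have np: "norm_power lam' ?k x = norm_power lam m x ^ ?k + l * norm (coord x ?k) ^ ?e" for x
    proof -
      have "group_norm s V lam' m x = group_norm s V lam m x"
        by (rule group_norm_cong) (simp add: lam'_def)
      moreover have "lam' ?k = l" by (simp add: lam'_def)
      ultimately show ?thesis
        by (simp only: norm_power_Suc[OF less_imp_le[OF lam'] Suc.hyps])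
    qed
    have "norm_power lam' ?k (bch s br g h) / 2 ^ (2 * fact ?k) + C' * defect ?k g h ^ (2 * fact (?k - 1))
      \<le> (norm_power lam' ?k g + norm_power lam' ?k h) / 2" for g h
    proof -
      let ?x = "bch s br g h"
      let ?r = "size_upto m g h" and ?d = "defect m g h"
      define a where "a = norm_power lam m g"
      define b where "b = norm_power lam m h"
      define c where "c = norm_power lam m ?x / 2 ^ ?e"
      define u where "u = norm (coord g ?k)"
      define v where "v = norm (coord h ?k)"
      define p where "p = norm (coord ?x ?k - coord g ?k - coord h ?k)"
      have r: "0 \<le> ?r" and d: "0 \<le> ?d" by (auto intro: size_upto_nonneg defect_nonneg)
      have abc: "0 \<le> a" "0 \<le> b" "0 \<le> c" unfolding a_def b_def c_def
        using lam by (auto intro!: divide_nonneg_nonneg zero_le_power group_norm_nonneg less_imp_le)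
      have uvp: "0 \<le> u" "0 \<le> v" "0 \<le> p" by (simp_all add: u_def v_def p_def)
      have gap: "C * ?d ^ ?e' \<le> (a + b) / 2 - c" using IH[of g h] unfolding a_def b_def c_def by linarith
      have "0 \<le> C * ?d ^ ?e'" using C d by simp
      with gap have cab: "c \<le> (a + b) / 2" by linarith
      have lower: "\<kappa> * (?r * ?d) ^ ?e \<le> ((a + b) / 2) ^ m * ((a + b) / 2 - c)"
      proof -
        have dr: "?d \<le> real m * 2 * ?r ^ m" by (intro weighted_sum_spread_le) simp
        have "(?r * ?d) ^ ?e = ?r ^ ?e * (?d ^ ?e' * ?d ^ ((m - 1) * ?e'))"
        proof -
          have "?e = ?e' + (m - 1) * ?e'" unfolding em using Suc.hyps by (cases m) auto
          then have "?d ^ ?e = ?d ^ ?e' * ?d ^ ((m - 1) * ?e')" by (metis power_add)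
          then show ?thesis by (simp add: power_mult_distrib)
        qed
        also have "\<dots> \<le> ?r ^ ?e * (?d ^ ?e' * (real m * 2 * ?r ^ m) ^ ((m - 1) * ?e'))"
          using r d dr by (intro mult_left_mono power_mono) auto
        also have "\<dots> = c0 * ((?r ^ ?e) ^ m * ?d ^ ?e')"
        proof -
          have "(?r ^ m) ^ ((m - 1) * ?e') = (?r ^ ?e) ^ (m - 1)"
            unfolding em by (simp only: power_mult[symmetric] mult_ac)
          moreover have "(?r ^ ?e) ^ m = ?r ^ ?e * (?r ^ ?e) ^ (m - 1)"
            using Suc.hyps by (cases m) auto
          ultimately show ?thesis unfolding c0_def by (simp only: power_mult_distrib mult_ac)
        qed
        finally have "\<kappa> * (?r * ?d) ^ ?e \<le> \<kappa> * (c0 * ((?r ^ ?e) ^ m * ?d ^ ?e'))"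
          using \<kappa> by (intro mult_left_mono) auto
        also have "\<dots> = (?r ^ ?e / (2 * K)) ^ m * (C * ?d ^ ?e')"
          using c0 K(1) unfolding \<kappa>_def by (simp add: power_divide)
        also have "\<dots> \<le> ((a + b) / 2) ^ m * ((a + b) / 2 - c)"
        proof (intro mult_mono power_mono gap)
          show "?r ^ ?e / (2 * K) \<le> (a + b) / 2"
            using K(2)[of g h] K(1) by (simp add: a_def b_def field_simps)
        qed (use abc r K(1) d C in auto)
        finally show ?thesis .
      qed
      have top: "l * norm (coord ?x ?k) ^ ?e / 2 ^ (?e * ?k)
          \<le> l / 4 * (u ^ ?e + v ^ ?e) + \<kappa> / 2 * (?r * ?d) ^ ?e"
      proof -
        have x: "norm (coord ?x ?k) \<le> u + v + p"
        proof -
          have "coord ?x ?k = coord g ?k + coord h ?k + (coord ?x ?k - coord g ?k - coord h ?k)" by simp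
          then show ?thesis unfolding u_def v_def p_def
            using norm_triangle_ineq[of "coord g ?k + coord h ?k" "coord ?x ?k - coord g ?k - coord h ?k"]
              norm_triangle_ineq[of "coord g ?k" "coord h ?k"] by simp
        qed
        have p: "p \<le> bch_bound * (?r * ?d)"
          unfolding p_def using Suc by (intro norm_coord_bch_error_le) auto
        \<comment> \<open>The factor \<open>2 ^ (- 2 (m + 1)!)\<close> is at most the \<open>4 ^ (- e)\<close> needed for averaging three terms.\<close>
        have "(4::real) ^ ?e = 2 ^ (?e * 2)" by (simp add: power_mult power_mult_distrib[symmetric] mult.commute[of _ 2])
        also have "\<dots> \<le> 2 ^ (?e * ?k)"
          using Suc.hyps by (intro power_increasing mult_left_mono) auto
        finally have four: "(4::real) ^ ?e \<le> 2 ^ (?e * ?k)" .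
        have "norm (coord ?x ?k) ^ ?e / 2 ^ (?e * ?k) \<le> (u + v + p) ^ ?e / 4 ^ ?e"
          using x four by (intro frac_le power_mono) auto
        also have "\<dots> = ((u + v + p) / 4) ^ ?e" by (simp add: power_divide)
        also have "\<dots> \<le> (u ^ ?e + v ^ ?e) / 4 + p ^ ?e"
          using uvp by (rule add3_power_le)
        also have "\<dots> \<le> (u ^ ?e + v ^ ?e) / 4 + (bch_bound * (?r * ?d)) ^ ?e"
          using p uvp by (intro add_left_mono power_mono) auto
        finally have "l * (norm (coord ?x ?k) ^ ?e / 2 ^ (?e * ?k))
            \<le> l * ((u ^ ?e + v ^ ?e) / 4 + (bch_bound * (?r * ?d)) ^ ?e)"
          using l by (intro mult_left_mono) auto
        also have "\<dots> = l / 4 * (u ^ ?e + v ^ ?e) + l * bch_bound ^ ?e * (?r * ?d) ^ ?e"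
          by (simp add: power_mult_distrib field_simps)
        also have "l * bch_bound ^ ?e = \<kappa> / 2"
          using bch_bound_ge_1 by (simp add: l_def)
        finally show ?thesis by simp
      qed
      have defect: "C' * defect ?k g h ^ ?e \<le> \<kappa> / 2 * (?r * ?d) ^ ?e + l / 4 * (u ^ ?e + v ^ ?e)"
      proof -
        define w where "w = ?r * ?d"
        have w: "0 \<le> w" using r d by (simp add: w_def)
        have "defect ?k g h ^ ?e \<le> (D * (w + (u + v))) ^ ?e"
          using D(2)[of g h] by (intro power_mono defect_nonneg) (simp add: u_def v_def w_def)
        also have "\<dots> = (4 * D) ^ ?e * ((u + v + w) / 4) ^ ?e"
        proof -
          have "D * (w + (u + v)) = 4 * D * ((u + v + w) / 4)" by simp
          then show ?thesis by (simp only: power_mult_distrib)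
        qed
        also have "\<dots> \<le> (4 * D) ^ ?e * ((u ^ ?e + v ^ ?e) + w ^ ?e)"
        proof (rule mult_left_mono)
          have "0 \<le> u ^ ?e + v ^ ?e" using uvp by simp
          then show "((u + v + w) / 4) ^ ?e \<le> (u ^ ?e + v ^ ?e) + w ^ ?e"
            by (intro order_trans[OF add3_power_le[OF uvp(1,2) w]] add_right_mono) simp
        qed (use D in simp)
        finally have "C' * defect ?k g h ^ ?e \<le> C' * ((4 * D) ^ ?e * ((u ^ ?e + v ^ ?e) + w ^ ?e))"
          using C' by (intro mult_left_mono) auto
        also have "\<dots> = \<mu> * w ^ ?e + \<mu> * (u ^ ?e + v ^ ?e)"
          using D(1) by (simp add: C'_def algebra_simps)
        also have "\<dots> \<le> \<kappa> / 2 * w ^ ?e + l / 4 * (u ^ ?e + v ^ ?e)"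
          using uvp w by (intro add_mono mult_right_mono) (auto simp: \<mu>_def)
        finally show ?thesis by (simp only: w_def)
      qed
      have lift: "c ^ ?k + ((a + b) / 2) ^ m * ((a + b) / 2 - c) \<le> (a ^ ?k + b ^ ?k) / 2"
        using abc cab by (intro convexity_gap_lift)
      have "norm_power lam' ?k ?x / 2 ^ (2 * fact ?k) = c ^ ?k + l * norm (coord ?x ?k) ^ ?e / 2 ^ (?e * ?k)"
        unfolding np c_def unfolding ek by (simp only: add_divide_distrib power_divide power_mult)
      moreover have "(norm_power lam' ?k g + norm_power lam' ?k h) / 2
          = (a ^ ?k + b ^ ?k) / 2 + l / 2 * (u ^ ?e + v ^ ?e)"
        unfolding np a_def b_def u_def v_def by (simp add: field_simps)
      moreover have "l / 2 * (u ^ ?e + v ^ ?e) = l / 4 * (u ^ ?e + v ^ ?e) + l / 4 * (u ^ ?e + v ^ ?e)"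
        by simp
      moreover have "\<kappa> * (?r * ?d) ^ ?e = \<kappa> / 2 * (?r * ?d) ^ ?e + \<kappa> / 2 * (?r * ?d) ^ ?e"
        by simp
      ultimately show ?thesis
        unfolding diff_Suc_1 using lower top defect lift by linarith
    qed
    with lam' C' have "?P ?k lam' C'" by blast
    then show ?case by blast
  qed
  then show ?thesis using that by blast
qed

section \<open>The vertical part of a product\<close>

text \<open>
  By the commutator estimate the coordinates of \<open>x = gh\<close> of degree \<open>j \<ge> 2\<close> are already \<open>O(\<eta>\<^sub>j)\<close>.  Multiplying
  by \<open>- x\<^sub>1\<close> from the left removes the horizontal part and adds commutators of \<open>- x\<^sub>1\<close> and \<open>x\<close>;
  the same estimate applies to them, now with the coordinates of degree at least 2 of \<open>x\<close> as the
  small quantities and no horizontal contribution.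
\<close>

lemma vertical_part_le:
  assumes s: "1 \<le> s"
  obtains K where "0 \<le> K"
    "\<And>g h j. j \<in> {1..s} \<Longrightarrow>
      norm (coord (bch s br (- horizontal s V (bch s br g h)) (bch s br g h)) j)
        \<le> K * weighted_sum (size_upto s g h) (spread g h) j"
proof
  define D where "D = real s * 2 * bch_bound"
  define K where "K = bch_bound + bch_bound * D * (real s * (D ^ s * bch_bound))"
  have B: "1 \<le> bch_bound" by (rule bch_bound_ge_1)
  have D: "1 \<le> D"
    using mult_mono[of 1 "real s * 2" 1 bch_bound] B s by (simp add: D_def)
  have K: "bch_bound \<le> K" using B D by (simp add: K_def)
  then show "0 \<le> K" using B by simp
  fix g h j assume j: "j \<in> {1..s}"
  let ?x = "bch s br g h" and ?r = "size_upto s g h" and ?W = "weighted_sum (size_upto s g h) (spread g h)"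
  let ?z = "- horizontal s V ?x"
  define t' where "t' i = (if i = 1 then 0 else bch_bound * ?W i)" for i
  have r: "0 \<le> ?r" by (rule size_upto_nonneg)
  have W: "0 \<le> ?W i" for i by (intro weighted_sum_nonneg r spread_nonneg)
  have z: "coord ?z i = (if i = 1 then - coord ?x 1 else 0)" for i
    by (simp add: coord_minus coord_horizontal[OF s])
  have x1: "norm (coord ?x 1) \<le> D * ?r"
  proof -
    have "norm (coord ?x 1) \<le> norm (coord g 1) + norm (coord h 1)"
      unfolding coord_bch_1[OF s] by (rule norm_triangle_ineq)
    also have "\<dots> \<le> 2 * ?r"
      using norm_coord_le_size(1)[of 1 s g h] norm_coord_le_size(2)[of 1 s h g] s by simp
    also have "\<dots> \<le> D * ?r"
      using mult_mono[of 1 "real s" 1 bch_bound] B s r by (intro mult_right_mono) (auto simp: D_def)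
    finally show ?thesis .
  qed
  have x: "norm (coord ?x i) \<le> bch_bound * ?W i" if i: "i \<in> {2..s}" for i
  proof -
    obtain m where m: "i = Suc m" "1 \<le> m" "m < s"
      using i by (cases i) auto
    have "norm (coord ?x i) = norm ((coord ?x i - coord g i - coord h i) + (coord g i + coord h i))"
      by simp
    also have "\<dots> \<le> bch_bound * (?r * ?W m) + spread g h i"
      using norm_coord_bch_error_le[of m s g h] m norm_triangle_ineq[of "coord g i" "coord h i"]
      by (intro order_trans[OF norm_triangle_ineq] add_mono) (auto simp: spread_def)
    also have "\<dots> \<le> bch_bound * (?r * ?W m) + bch_bound * spread g h i"
      using mult_right_mono[OF B spread_nonneg[of g h i]] by simp
    also have "\<dots> = bch_bound * ?W i"
      by (simp add: m weighted_sum_Suc distrib_left)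
    finally show ?thesis .
  qed
  have xr: "norm (coord ?x i) \<le> (D * ?r) ^ i" if i: "i \<in> {1..s}" for i
  proof (cases "i = 1")
    case False
    with i have "norm (coord ?x i) \<le> bch_bound * ?W i" by (intro x) auto
    also have "\<dots> \<le> bch_bound * (real i * 2 * ?r ^ i)"
      using B i by (intro mult_left_mono weighted_sum_spread_le) auto
    also have "\<dots> = real i * 2 * bch_bound * ?r ^ i" by simp
    also have "\<dots> \<le> D ^ i * ?r ^ i"
    proof (rule mult_right_mono)
      have "real i * 2 * bch_bound \<le> D"
        unfolding D_def using B i by (intro mult_right_mono) auto
      also have "D \<le> D ^ i" using D i by (intro self_le_power) auto
      finally show "real i * 2 * bch_bound \<le> D ^ i" .
    qed (use r in simp)
    finally show ?thesis by (simp add: power_mult_distrib)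
  qed (use x1 in simp)
  show "norm (coord (bch s br ?z ?x) j) \<le> K * ?W j"
  proof (cases "j = 1")
    case True
    have "coord (bch s br ?z ?x) 1 = 0" by (simp add: coord_bch_1[OF s] z del: One_nat_def)
    with True W K B show ?thesis by simp
  next
    case False
    with j obtain m where m: "j = Suc m" "1 \<le> m" "m < s" by (cases j) auto
    have "norm (coord (bch s br ?z ?x) j - coord ?z j - coord ?x j)
        \<le> bch_bound * (D * ?r * weighted_sum (D * ?r) t' (j - 1))"
    proof (rule norm_coord_bch_le)
      have "br (coord ?z 1) (coord ?x 1) = 0"
        using bilinear by (simp add: z bilinear_lneg alternating del: One_nat_def)
      then show "norm (br (coord ?z 1) (coord ?x 1)) \<le> bracket_bound * (D * ?r * t' 1)"
        by (simp add: t'_def)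
    qed (use D r W B j x xr xr[of 1] z s in \<open>auto simp: t'_def\<close>)
    also have "\<dots> \<le> bch_bound * (D * ?r * (real m * (D ^ m * bch_bound) * ?W m))"
    proof -
      have "weighted_sum (D * ?r) t' m \<le> real m * (D ^ m * bch_bound) * ?W m"
        using r D B W by (intro weighted_sum_scale_le spread_nonneg) (auto simp: t'_def)
      then show ?thesis using B D r m by (intro mult_left_mono) auto
    qed
    also have "\<dots> = bch_bound * D * (real m * (D ^ m * bch_bound)) * (?r * ?W m)"
      by (simp add: mult_ac)
    also have "\<dots> \<le> bch_bound * D * (real s * (D ^ s * bch_bound)) * ?W j"
      using m B D r W spread_nonneg[of g h j]
      by (intro mult_mono power_increasing) (auto simp: weighted_sum_Suc)
    finally have "norm (coord (bch s br ?z ?x) j - coord ?z j - coord ?x j)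
      \<le> bch_bound * D * (real s * (D ^ s * bch_bound)) * ?W j" .
    moreover have "norm (coord ?x j) \<le> bch_bound * ?W j"
      using j False by (intro x) auto
    moreover have "norm (coord (bch s br ?z ?x) j)
        \<le> norm (coord (bch s br ?z ?x) j - coord ?z j - coord ?x j) + norm (coord ?x j)"
      using norm_triangle_ineq[of "coord (bch s br ?z ?x) j - coord ?z j - coord ?x j" "coord ?x j"]
        False by (simp add: z)
    ultimately show ?thesis by (simp add: K_def distrib_right)
  qed
qed

text \<open>
  All but one of the \<open>k\<close> factors \<open>|g\<^sub>1 - h\<^sub>1|\<close> are bounded by twice the size, leaving a term of
  the defect.
\<close>

lemma horizontal_difference_le:
  assumes "1 \<le> k"
  shows "norm (coord g 1 - coord h 1) ^ (2 * fact k)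
    \<le> 2 ^ ((k - 1) * (2 * fact (k - 1))) * defect k g h ^ (2 * fact (k - 1))"
proof -
  let ?d = "norm (coord g 1 - coord h 1)" and ?r = "size_upto k g h"
  have r: "0 \<le> ?r" by (rule size_upto_nonneg)
  have d: "?d = spread g h 1" by (simp add: spread_def)
  then have dr: "?d \<le> 2 * ?r"
    using spread_le_size[of 1 k g h] assms by simp
  have "?d ^ k = ?d ^ (k - 1) * ?d"
    using assms by (cases k) auto
  also have "\<dots> \<le> (2 * ?r) ^ (k - 1) * ?d"
    using dr by (intro mult_right_mono power_mono) auto
  also have "\<dots> = 2 ^ (k - 1) * (?r ^ (k - 1) * spread g h 1)"
    by (simp only: d power_mult_distrib mult.assoc)
  also have "\<dots> \<le> 2 ^ (k - 1) * defect k g h"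
    using assms r by (intro mult_left_mono term_le_weighted_sum spread_nonneg) auto
  finally have "(?d ^ k) ^ (2 * fact (k - 1)) \<le> (2 ^ (k - 1) * defect k g h) ^ (2 * fact (k - 1))"
    by (intro power_mono) auto
  moreover have "2 * fact k = k * (2 * fact (k - 1))"
    using assms by (simp add: fact_reduce)
  ultimately show ?thesis
    by (simp only: power_mult power_mult_distrib)
qed

end

theorem proposition7p2:
  fixes br :: "'a::euclidean_space \<Rightarrow> 'a \<Rightarrow> 'a"
    and V :: "nat \<Rightarrow> 'a set"
    and s :: nat
  assumes "graded_lie_algebra br s V"
    and "2 \<le> s"
  shows "\<exists>(lam :: nat \<Rightarrow> real) (C :: real).
    (\<forall>k\<in>{2..s}. 0 < lam k) \<and> 0 < C \<and>
    (\<forall>N. N = group_norm s V lam s \<longrightarrow>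
      (\<forall>g h.
        (1 / 2) * (N g ^ (2 * fact s) + N h ^ (2 * fact s))
        \<ge> (N (bch s br g h) / 2) ^ (2 * fact s)
          + C * 2 powi (- (2 * fact s))
              * (norm (layer s V g 1 - layer s V h 1) ^ (2 * fact s)
                 + NH s br V N (bch s br g h) ^ (2 * fact s))))"
proof -
  interpret graded_lie_algebra br s V by fact
  have s: "1 \<le> s" using \<open>2 \<le> s\<close> by simp
  let ?p = "2 * fact s :: nat" and ?q = "2 * fact (s - 1) :: nat"
  obtain lam C where lam: "\<And>j. 0 < lam j" and C: "0 < C" and convex:
    "\<And>g h. norm_power lam s (bch s br g h) / 2 ^ ?p + C * defect s g h ^ ?q
      \<le> (norm_power lam s g + norm_power lam s h) / 2"
    using midpoint_convexity[OF s order_refl] by metis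
  obtain K where K: "0 \<le> K" and vertical: "\<And>g h j. j \<in> {1..s} \<Longrightarrow>
      norm (coord (bch s br (- horizontal s V (bch s br g h)) (bch s br g h)) j)
        \<le> K * weighted_sum (size_upto s g h) (spread g h) j"
    using vertical_part_le[OF s] by metis
  obtain K' where K': "0 < K'" and power_le: "\<And>y r t. \<lbrakk>0 \<le> r; \<And>i. 0 \<le> t i;
      \<And>i. i \<in> {1..s} \<Longrightarrow> t i \<le> 2 * r ^ i;
      \<And>j. j \<in> {1..s} \<Longrightarrow> norm (coord y j) \<le> K * weighted_sum r t j\<rbrakk>
     \<Longrightarrow> norm_power lam s y \<le> K' * weighted_sum r t s ^ ?q"
    using norm_power_le_weighted_sum[where lam = lam, OF s lam K] by metis
  define E where "E = 2 ^ ((s - 1) * ?q) + K'"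
  have E: "0 < E" using K' by (simp add: E_def add_pos_pos)
  let ?N = "group_norm s V lam s"
  have "(?N (bch s br g h) / 2) ^ ?p + C / E * 2 powi (- (2 * fact s))
        * (norm (coord g 1 - coord h 1) ^ ?p + NH s br V ?N (bch s br g h) ^ ?p)
      \<le> 1 / 2 * (?N g ^ ?p + ?N h ^ ?p)" for g h
  proof -
    let ?u = "norm (coord g 1 - coord h 1) ^ ?p + NH s br V ?N (bch s br g h) ^ ?p"
    have u0: "0 \<le> ?u"
      unfolding NH_def using lam
      by (auto intro!: add_nonneg_nonneg zero_le_power group_norm_nonneg intro: less_imp_le)
    have "NH s br V ?N (bch s br g h) ^ ?p \<le> K' * defect s g h ^ ?q"
      unfolding NH_def group_inv_def
      by (intro power_le size_upto_nonneg spread_nonneg spread_le_size vertical)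
    then have u: "?u \<le> E * defect s g h ^ ?q"
      using horizontal_difference_le[OF s, of g h] by (simp add: E_def distrib_right)
    have "2 powi (- (2 * fact s)) \<le> (1::real)"
      by (simp add: power_int_minus inverse_le_1_iff one_le_power_int)
    then have "C / E * 2 powi (- (2 * fact s)) * ?u \<le> C / E * 1 * (E * defect s g h ^ ?q)"
      using C E u u0 by (intro mult_mono) auto
    also have "\<dots> = C * defect s g h ^ ?q" using E by simp
    finally show ?thesis using convex[of g h] unfolding power_divide by linarith
  qed
  then show ?thesis
    using lam C E by (intro exI[of _ lam] exI[of _ "C / E"]) auto
qed

end
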